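(* Let $\mathcal A\subseteq\mathbb N$, $L$ an environment and $T,U_1,U_2$ terms. If $L\vdash_{\mathcal A}T:U_1$ and $L\vdash_{\mathcal A}T:U_2$, then there exists a term $U_0$ such that $L\vdash U_1\to^{*0}U_0$ and $L\vdash U_2\to^{*0}U_0$.
   Context: Fix a nonempty set $\Sigma$ of sorts with decidable equality, an arbitrary function $\mathrm{next}:\Sigma\to\Sigma$, and a countably infinite set of variables. Terms and environments: $T,U,V,W ::= \star s \mid x \mid \mathrm{app}(V,T) \mid \lambda x{:}W.\,T \mid \mathrm{def}(x{=}V).\,T \mid \mathrm{cast}(U,T)$ ($s\in\Sigma$) and $L,K ::= \emptyset \mid K,x{:}W \mid K,x{=}V$. $\mathrm{app}(V,T)$ applies $T$ to $V$; $\lambda x{:}W.\,T$ (de Bruijn's abstraction) and $\mathrm{def}(x{=}V).\,T$ (local definition) bind $x$ in $T$; $\mathrm{cast}(U,T)$ annotates $T$ with expected type $U$; entries $x{:}W$ and $x{=}V$ bind $x$. Terms are modulo renaming of bound variables. Write $\mathsf{B}x[V]$ for either $\lambda x{:}V$ or $\mathrm{def}(x{=}V)$ and correspondingly $L,x[V]$ for $L,x{:}V$ resp. $L,x{=}V$. One step of bound rt-reduction $L\vdash T_1\to^nT_2$ is the smallest relation closed under: $L\vdash\mathrm{app}(V,\lambda x{:}W.\,T)\to^0\mathrm{def}(x{=}\mathrm{cast}(W,V)).\,T$; $K,x{=}V\vdash x\to^0V$; $L\vdash\mathrm{def}(x{=}V).\,T\to^0T$ if $x$ not free in $T$; $L\vdash\mathrm{app}(V,\mathrm{def}(x{=}W).\,T)\to^0\mathrm{def}(x{=}W).\,\mathrm{app}(V,T)$;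 $L\vdash\mathrm{cast}(U,T)\to^0T$; $L\vdash\star s\to^1\star\,\mathrm{next}(s)$; $K,x{:}W\vdash x\to^1W$; $L\vdash\mathrm{cast}(U,T)\to^1U$; if $K\vdash x\to^nT$, $y\neq x$, $y$ not free in $T$ then $K,y[V]\vdash x\to^nT$; if $L\vdash V_1\to^0V_2$ then $L\vdash\mathrm{app}(V_1,T)\to^0\mathrm{app}(V_2,T)$; if $L\vdash T_1\to^nT_2$ then $L\vdash\mathrm{app}(V,T_1)\to^n\mathrm{app}(V,T_2)$; if $L\vdash V_1\to^0V_2$ then $L\vdash\mathsf Bx[V_1].\,T\to^0\mathsf Bx[V_2].\,T$; if $L,x[V]\vdash T_1\to^nT_2$ then $L\vdash\mathsf Bx[V].\,T_1\to^n\mathsf Bx[V].\,T_2$; if $L\vdash U_1\to^0U_2$ then $L\vdash\mathrm{cast}(U_1,T)\to^0\mathrm{cast}(U_2,T)$; if $L\vdash T_1\to^0T_2$ then $L\vdash\mathrm{cast}(U,T_1)\to^0\mathrm{cast}(U,T_2)$; if $L\vdash U_1\to^1U_2$ and $L\vdash T_1\to^1T_2$ then $L\vdash\mathrm{cast}(U_1,T_1)\to^1\mathrm{cast}(U_2,T_2)$. $L\vdash T_1\to^{*n}T_2$ is the smallest relation with $L\vdash T\to^{*0}T$, containing single steps, and with $L\vdash T_1\to^{*n_1}T$, $L\vdash T\to^{*n_2}T_2$ implying $L\vdash T_1\to^{*n_1+n_2}T_2$. Validity $L\vdash_{\mathcal A}T$ is the smallest predicate closed under: $L\vdash_{\mathcal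 A}\star s$; if $K\vdash_{\mathcal A}V$ then $K,x[V]\vdash_{\mathcal A}x$; if $K\vdash_{\mathcal A}x$ and $y\neq x$ then $K,y[V]\vdash_{\mathcal A}x$; if $L\vdash_{\mathcal A}V$ and $L,x[V]\vdash_{\mathcal A}T$ then $L\vdash_{\mathcal A}\mathsf Bx[V].\,T$; if $L\vdash_{\mathcal A}U$, $L\vdash_{\mathcal A}T$ and some $U_0$ satisfies $L\vdash T\to^{*1}U_0$, $L\vdash U\to^{*0}U_0$, then $L\vdash_{\mathcal A}\mathrm{cast}(U,T)$; if $L\vdash_{\mathcal A}V$, $L\vdash_{\mathcal A}T$ and there are $n\in\mathcal A$, $x,W_0,U_0$ with $L\vdash T\to^{*n}\lambda x{:}W_0.\,U_0$ and $L\vdash V\to^{*1}W_0$, then $L\vdash_{\mathcal A}\mathrm{app}(V,T)$. The type judgment $L\vdash_{\mathcal A}T:U$ means $L\vdash_{\mathcal A}\mathrm{cast}(U,T)$. *)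

theory Defs
  imports Main
begin

text \<open>
  Terms modulo renaming of bound variables, in de Bruijn notation: \<open>Var i\<close> refers to the
  binder crossed \<open>i\<close>-th (from \<open>0\<close>) on the way outwards, first through the enclosing term and then
  through the environment. Indices pointing beyond the environment are free variables that it does
  not bind. \<open>Bind b V T\<close> is \<open>Bx[V].T\<close>; only \<open>T\<close> is in the scope of the binder.
  Sorts are the elements of the (arbitrary, nonempty) type \<open>'s\<close>.
\<close>

datatype bkind = Decl | Defn

datatype 's trm =
    Sort 's
  | Var nat
  | App "'s trm" "'s trm"  \<comment> \<open>\<open>App V T\<close> applies \<open>T\<close> to \<open>V\<close>\<close>
  | Bind bkind "'s trm" "'s trm"
  | Cast "'s trm" "'s trm"

abbreviation Lam :: "'s trm \<Rightarrow> 's trm \<Rightarrow> 's trm" where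
  "Lam W T \<equiv> Bind Decl W T"

abbreviation Def :: "'s trm \<Rightarrow> 's trm \<Rightarrow> 's trm" where
  "Def V T \<equiv> Bind Defn V T"

text \<open>
  The head of the list is the most recent (rightmost) entry: \<open>K, x[V]\<close> is \<open>(b, V) # K\<close>, with \<open>x\<close>
  becoming index \<open>0\<close> and the indices of \<open>V\<close> referring to \<open>K\<close>.
\<close>

type_synonym 's env = "(bkind \<times> 's trm) list"

text \<open>
  \<open>lift k T\<close> makes room for a binder at level \<open>k\<close>. In particular \<open>lift 0 T\<close> is \<open>T\<close> weakened by one
  variable \<open>x\<close>, and \<open>x\<close> (index \<open>0\<close>) is not free in a term iff the term is of the form \<open>lift 0 T\<close>.
\<close>

primrec lift :: "nat \<Rightarrow> 's trm \<Rightarrow> 's trm" where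
  "lift k (Sort s) = Sort s"
| "lift k (Var i) = Var (if i < k then i else Suc i)"
| "lift k (App V T) = App (lift k V) (lift k T)"
| "lift k (Bind b V T) = Bind b (lift k V) (lift (Suc k) T)"
| "lift k (Cast U T) = Cast (lift k U) (lift k T)"

text \<open>
  \<open>rt_step nxt L n T1 T2\<close> is \<open>L \<turnstile> T1 \<rightarrow>\<^sup>n T2\<close>. The occurrences of \<open>lift 0\<close> express that
  a variable is not free in a term: by side condition in \<open>drop\<close> and \<open>weak\<close>, by the convention on
  bound variables in \<open>defn\<close>, \<open>decl\<close> and \<open>swap\<close>.
\<close>

inductive rt_step :: "('s \<Rightarrow> 's) \<Rightarrow> 's env \<Rightarrow> nat \<Rightarrow> 's trm \<Rightarrow> 's trm \<Rightarrow> bool"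
  for nxt :: "'s \<Rightarrow> 's"
where
  beta: "rt_step nxt L 0 (App V (Lam W T)) (Def (Cast W V) T)"
| defn: "rt_step nxt ((Defn, V) # K) 0 (Var 0) (lift 0 V)"
| drop: "rt_step nxt L 0 (Def V (lift 0 T)) T"
| swap: "rt_step nxt L 0 (App V (Def W T)) (Def W (App (lift 0 V) T))"
| uncast: "rt_step nxt L 0 (Cast U T) T"
| sort: "rt_step nxt L 1 (Sort s) (Sort (nxt s))"
| decl: "rt_step nxt ((Decl, W) # K) 1 (Var 0) (lift 0 W)"
| cast_type: "rt_step nxt L 1 (Cast U T) U"
| weak: "rt_step nxt K n (Var i) T \<Longrightarrow> rt_step nxt ((b, V) # K) n (Var (Suc i)) (lift 0 T)"
| app_arg: "rt_step nxt L 0 V1 V2 \<Longrightarrow> rt_step nxt L 0 (App V1 T) (App V2 T)"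
| app_fun: "rt_step nxt L n T1 T2 \<Longrightarrow> rt_step nxt L n (App V T1) (App V T2)"
| bind_ann: "rt_step nxt L 0 V1 V2 \<Longrightarrow> rt_step nxt L 0 (Bind b V1 T) (Bind b V2 T)"
| bind_body: "rt_step nxt ((b, V) # L) n T1 T2 \<Longrightarrow> rt_step nxt L n (Bind b V T1) (Bind b V T2)"
| cast_left: "rt_step nxt L 0 U1 U2 \<Longrightarrow> rt_step nxt L 0 (Cast U1 T) (Cast U2 T)"
| cast_right: "rt_step nxt L 0 T1 T2 \<Longrightarrow> rt_step nxt L 0 (Cast U T1) (Cast U T2)"
| cast_both: "\<lbrakk>rt_step nxt L 1 U1 U2; rt_step nxt L 1 T1 T2\<rbrakk>
    \<Longrightarrow> rt_step nxt L 1 (Cast U1 T1) (Cast U2 T2)"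

inductive rt_steps :: "('s \<Rightarrow> 's) \<Rightarrow> 's env \<Rightarrow> nat \<Rightarrow> 's trm \<Rightarrow> 's trm \<Rightarrow> bool"
  for nxt :: "'s \<Rightarrow> 's" and L :: "'s env"
where
  refl: "rt_steps nxt L 0 T T"
| single: "rt_step nxt L n T1 T2 \<Longrightarrow> rt_steps nxt L n T1 T2"
| trans: "\<lbrakk>rt_steps nxt L n1 T1 T; rt_steps nxt L n2 T T2\<rbrakk> \<Longrightarrow> rt_steps nxt L (n1 + n2) T1 T2"

inductive valid :: "('s \<Rightarrow> 's) \<Rightarrow> nat set \<Rightarrow> 's env \<Rightarrow> 's trm \<Rightarrow> bool"
  for nxt :: "'s \<Rightarrow> 's" and A :: "nat set"
where
  sort: "valid nxt A L (Sort s)"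
| var_0: "valid nxt A K V \<Longrightarrow> valid nxt A ((b, V) # K) (Var 0)"
| var_Suc: "valid nxt A K (Var i) \<Longrightarrow> valid nxt A ((b, V) # K) (Var (Suc i))"
| bind: "\<lbrakk>valid nxt A L V; valid nxt A ((b, V) # L) T\<rbrakk> \<Longrightarrow> valid nxt A L (Bind b V T)"
| cast: "\<lbrakk>valid nxt A L U; valid nxt A L T; rt_steps nxt L 1 T U0; rt_steps nxt L 0 U U0\<rbrakk>
    \<Longrightarrow> valid nxt A L (Cast U T)"
| app: "\<lbrakk>valid nxt A L V; valid nxt A L T; n \<in> A;
      rt_steps nxt L n T (Lam W0 U0); rt_steps nxt L 1 V W0\<rbrakk>
    \<Longrightarrow> valid nxt A L (App V T)"

definition has_type :: "('s \<Rightarrow> 's) \<Rightarrow> nat set \<Rightarrow> 's env \<Rightarrow> 's trm \<Rightarrow> 's trm \<Rightarrow> bool" where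
  "has_type nxt A L T U \<longleftrightarrow> valid nxt A L (Cast U T)"

end

theory Submission
  imports Defs "HOL-Library.Confluence"
begin

text \<open>
  A term is interpreted as the tower of its iterated types, in a pure lambda calculus in which every
  abstraction carries the whole tower of iterated types of its annotation; definitions are unfolded
  and casts are erased. For terms satisfying a semantic version of validity, a reduction step of
  degree \<open>n\<close> shifts the tower by \<open>n\<close>, up to beta equality. The usual circularity between
  confluence and preservation does not arise: in the beta case one needs that the annotation of the
  abstraction and the type of the argument agree at all levels, and this is read off the towers by
  injectivity of abstraction. So two types of a term have beta equal interpretations, and reading a
  common reduct back gives a common reduct of the types. No strong normalization is involved.
\<close>

section \<open>Lambda terms annotated by towers\<close>

datatype 's itrm =
    ISort 's
  | IVar nat
  | IApp "'s itrm" "'s itrm"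
  | ILam "nat \<Rightarrow> 's itrm" "'s itrm"

primrec ren :: "(nat \<Rightarrow> nat) \<Rightarrow> 's itrm \<Rightarrow> 's itrm" where
  "ren \<xi> (ISort s) = ISort s"
| "ren \<xi> (IVar x) = IVar (\<xi> x)"
| "ren \<xi> (IApp v t) = IApp (ren \<xi> v) (ren \<xi> t)"
| "ren \<xi> (ILam w u) = ILam (\<lambda>j. ren \<xi> (w j)) (ren (case_nat 0 (\<lambda>x. Suc (\<xi> x))) u)"

definition up :: "(nat \<Rightarrow> 's itrm) \<Rightarrow> nat \<Rightarrow> 's itrm" where
  "up \<theta> = case_nat (IVar 0) (\<lambda>x. ren Suc (\<theta> x))"

primrec isubst :: "(nat \<Rightarrow> 's itrm) \<Rightarrow> 's itrm \<Rightarrow> 's itrm" where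
  "isubst \<theta> (ISort s) = ISort s"
| "isubst \<theta> (IVar x) = \<theta> x"
| "isubst \<theta> (IApp v t) = IApp (isubst \<theta> v) (isubst \<theta> t)"
| "isubst \<theta> (ILam w u) = ILam (\<lambda>j. isubst \<theta> (w j)) (isubst (up \<theta>) u)"

section \<open>Laws of renaming and substitution\<close>

lemma up_simps [simp]: "up \<theta> 0 = IVar 0" "up \<theta> (Suc x) = ren Suc (\<theta> x)"
  by (simp_all add: up_def)

lemma ren_ren: "ren \<xi> (ren \<zeta> X) = ren (\<lambda>x. \<xi> (\<zeta> x)) X"
proof (induction X arbitrary: \<xi> \<zeta>)
  case (ILam w u)
  have "(\<lambda>x. case_nat 0 (\<lambda>x. Suc (\<xi> x)) (case_nat 0 (\<lambda>x. Suc (\<zeta> x)) x))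
      = case_nat 0 (\<lambda>x. Suc (\<xi> (\<zeta> x)))"
    by (auto split: nat.split)
  then show ?case using ILam by simp
qed auto

lemma isubst_ren: "isubst \<theta> (ren \<xi> X) = isubst (\<lambda>x. \<theta> (\<xi> x)) X"
proof (induction X arbitrary: \<theta> \<xi>)
  case (ILam w u)
  have "(\<lambda>x. up \<theta> (case_nat 0 (\<lambda>x. Suc (\<xi> x)) x)) = up (\<lambda>x. \<theta> (\<xi> x))"
    by (auto simp: up_def split: nat.split)
  then show ?case using ILam by simp
qed auto

lemma ren_isubst: "ren \<xi> (isubst \<theta> X) = isubst (\<lambda>x. ren \<xi> (\<theta> x)) X"
proof (induction X arbitrary: \<theta> \<xi>)
  case (ILam w u)
  have "(\<lambda>x. ren (case_nat 0 (\<lambda>x. Suc (\<xi> x))) (up \<theta> x)) = up (\<lambda>x. ren \<xi> (\<theta> x))"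
    by (auto simp: up_def ren_ren split: nat.split)
  then show ?case using ILam by simp
qed auto

lemma isubst_up_ren: "isubst (up \<theta>) (ren Suc X) = ren Suc (isubst \<theta> X)"
  by (simp add: isubst_ren ren_isubst)

lemma isubst_isubst: "isubst \<tau> (isubst \<theta> X) = isubst (\<lambda>x. isubst \<tau> (\<theta> x)) X"
proof (induction X arbitrary: \<theta> \<tau>)
  case (ILam w u)
  have "(\<lambda>x. isubst (up \<tau>) (up \<theta> x)) = up (\<lambda>x. isubst \<tau> (\<theta> x))"
    by (auto simp: up_def isubst_up_ren[unfolded up_def] split: nat.split)
  then show ?case using ILam by simp
qed auto

lemma up_IVar [simp]: "up IVar = IVar"
  by (auto simp: up_def split: nat.split)

lemma isubst_IVar [simp]: "isubst IVar X = X"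
  by (induction X) auto

lemma ren_eq_isubst: "ren \<xi> X = isubst (\<lambda>x. IVar (\<xi> x)) X"
  using ren_isubst[of \<xi> IVar X] by simp

lemma isubst_case_nat_ren [simp]: "isubst (case_nat v IVar) (ren Suc X) = X"
  by (simp add: isubst_ren)

lemma isubst_beta:
  "isubst \<theta> (isubst (case_nat v IVar) u) = isubst (case_nat (isubst \<theta> v) IVar) (isubst (up \<theta>) u)"
proof -
  have "(\<lambda>x. isubst \<theta> (case_nat v IVar x)) = (\<lambda>x. isubst (case_nat (isubst \<theta> v) IVar) (up \<theta> x))"
    by (auto simp: up_def split: nat.split)
  then show ?thesis by (simp add: isubst_isubst)
qed


section \<open>Parallel reduction of the first \<open>k\<close> levels\<close>

text \<open>
  Annotations of level at least \<open>k\<close> may change arbitrarily in a step. Hence \<open>par k\<close> behaves like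
  reduction of finitely annotated terms, and it grows as \<open>k\<close> decreases.
\<close>

inductive par :: "nat \<Rightarrow> 's itrm \<Rightarrow> 's itrm \<Rightarrow> bool" for k where
  par_sort: "par k (ISort s) (ISort s)"
| par_var: "par k (IVar x) (IVar x)"
| par_app: "par k v v' \<Longrightarrow> par k t t' \<Longrightarrow> par k (IApp v t) (IApp v' t')"
| par_lam: "(\<And>j. j < k \<Longrightarrow> par k (w j) (w' j)) \<Longrightarrow> par k u u' \<Longrightarrow> par k (ILam w u) (ILam w' u')"
| par_beta: "par k v v' \<Longrightarrow> par k u u' \<Longrightarrow>
    par k (IApp v (ILam w u)) (isubst (case_nat v' IVar) u')"

inductive_cases par_lamE: "par k (ILam w u) X"

lemma par_refl [simp]: "par k X X"
  by (induction X) (auto intro: par.intros)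

lemma par_mono: "par k X Y \<Longrightarrow> l \<le> k \<Longrightarrow> par l X Y"
  by (induction rule: par.induct) (auto intro: par.intros)

lemma par_ren:
  fixes X Y :: "'s itrm"
  shows "par k X Y \<Longrightarrow> par k (ren \<xi> X) (ren \<xi> Y)"
proof (induction arbitrary: \<xi> rule: par.induct)
  case (par_beta v v' u u' w)
  have "up (\<lambda>x. IVar (\<xi> x)) = (\<lambda>x. IVar (case_nat 0 (\<lambda>x. Suc (\<xi> x)) x) :: 's itrm)"
    by (auto simp: up_def split: nat.split)
  then have "ren \<xi> (isubst (case_nat v' IVar) u')
      = isubst (case_nat (ren \<xi> v') IVar) (ren (case_nat 0 (\<lambda>x. Suc (\<xi> x))) u')"
    by (simp only: ren_eq_isubst isubst_beta)
  then show ?case using par_beta by (auto intro: par.intros)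
qed (auto intro: par.intros)

lemma par_up: "(\<And>x. par k (\<theta> x) (\<theta>' x)) \<Longrightarrow> par k (up \<theta> x) (up \<theta>' x)"
  by (cases x) (auto intro: par_ren)

lemma par_isubst:
  "par k X Y \<Longrightarrow> (\<And>x. par k (\<theta> x) (\<theta>' x)) \<Longrightarrow> par k (isubst \<theta> X) (isubst \<theta>' Y)"
proof (induction arbitrary: \<theta> \<theta>' rule: par.induct)
  case (par_lam w w' u u')
  show ?case
    unfolding isubst.simps by (intro par.par_lam par_lam.IH par_up par_lam.prems)
next
  case (par_beta v v' u u' w)
  show ?case
    unfolding isubst.simps isubst_beta by (intro par.par_beta par_beta.IH par_up par_beta.prems)
qed (auto intro: par.intros)

section \<open>Confluence by complete developments\<close>

text \<open>Primitive recursion gives \<open>dev\<close> access to \<open>dev t\<close>, but not to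
  \<open>dev u\<close> when \<open>t\<close> is \<open>ILam w u\<close>. As \<open>dev\<close> keeps
  abstractions, \<open>body (dev t)\<close> recovers it; the other values are dummies.\<close>

primrec body :: "'s itrm \<Rightarrow> 's itrm" where
  "body (ISort s) = ISort s"
| "body (IVar x) = IVar x"
| "body (IApp v t) = IApp v t"
| "body (ILam w u) = u"

text \<open>Takahashi's complete development: it contracts all redexes of a term at once.\<close>

primrec dev :: "'s itrm \<Rightarrow> 's itrm" where
  "dev (ISort s) = ISort s"
| "dev (IVar x) = IVar x"
| "dev (IApp v t) = (case t of ILam w u \<Rightarrow> isubst (case_nat (dev v) IVar) (body (dev t))
    | _ \<Rightarrow> IApp (dev v) (dev t))"
| "dev (ILam w u) = ILam (\<lambda>j. dev (w j)) (dev u)"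

text \<open>Takahashi's triangle property: \<open>dev X\<close> depends on \<open>X\<close> alone,
  so it closes any two steps from \<open>X\<close>, which yields the diamond property for every
  bound \<open>k\<close>.\<close>

lemma par_dev: "par k X Y \<Longrightarrow> par k Y (dev X)"
proof (induction rule: par.induct)
  case (par_app v v' t t')
  show ?case
  proof (cases t)
    case (ILam w u)
    \<comment> \<open>An abstraction steps only to abstractions, so \<open>IApp v' t'\<close> is
      still a redex, and contracting it reaches the development.\<close>
    with par_app obtain w' u' where t': "t' = ILam w' u'" by (auto elim: par_lamE)
    with par_app ILam have "par k u' (dev u)" by (auto elim: par_lamE)
    with par_app ILam t' show ?thesis by (auto intro: par.intros)
  qed (use par_app in \<open>auto intro: par.intros\<close>)
next
  case (par_beta v v' u u' w)
  then show ?case by (auto intro!: par_isubst split: nat.split)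
qed (auto intro: par.intros)

lemma par_confluent: "confluentp (par k)"
proof (rule strong_confluentp_imp_confluentp, rule strong_confluentpI)
  fix X Y Z :: "'s itrm"
  assume "par k X Y" "par k X Z"
  then show "\<exists>U. (par k)\<^sup>*\<^sup>* Y U \<and> (par k)\<^sup>=\<^sup>= Z U"
    using par_dev by blast
qed

lemma pars_mono: "(par k)\<^sup>*\<^sup>* X Y \<Longrightarrow> l \<le> k \<Longrightarrow> (par l)\<^sup>*\<^sup>* X Y"
  using mono_rtranclp[of "par k" "par l"] par_mono by blast

section \<open>Reduction sequences inside abstractions\<close>

lemma pars_map:
  assumes "(par k)\<^sup>*\<^sup>* X Y" and "\<And>X Y. par k X Y \<Longrightarrow> par k (f X) (f Y)"
  shows "(par k)\<^sup>*\<^sup>* (f X) (f Y)"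
  using assms(1) by (induction rule: rtranclp_induct) (auto intro: rtranclp.rtrancl_into_rtrancl assms(2))

text \<open>The lengths of the reductions at different levels may be unbounded, so not all levels
  can be treated together. The bound \<open>k\<close> leaves finitely many, which are reduced one
  after the other.\<close>

lemma pars_annotation:
  assumes "\<And>j. j < k \<Longrightarrow> (par k)\<^sup>*\<^sup>* (w j) (z j)"
  shows "(par k)\<^sup>*\<^sup>* (ILam w u) (ILam z u)"
proof -
  have "m \<le> k \<Longrightarrow> (par k)\<^sup>*\<^sup>* (ILam w u) (ILam (\<lambda>j. if j < m then z j else w j) u)" for m
  proof (induction m)
    case (Suc m)
    let ?f = "\<lambda>X. ILam (\<lambda>j. if j < m then z j else if j = m then X else w j) u"
    have "(par k)\<^sup>*\<^sup>* (?f (w m)) (?f (z m))"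
      by (rule pars_map) (use assms Suc in \<open>auto intro: par.intros\<close>)
    moreover have "?f (w m) = ILam (\<lambda>j. if j < m then z j else w j) u"
      by (auto intro: ext)
    moreover have "?f (z m) = ILam (\<lambda>j. if j < Suc m then z j else w j) u"
      by (auto intro: ext simp: less_Suc_eq)
    ultimately show ?case using Suc by simp
  qed simp
  from this[of k] have "(par k)\<^sup>*\<^sup>* (ILam w u) (ILam (\<lambda>j. if j < k then z j else w j) u)" by simp
  \<comment> \<open>The infinitely many levels from \<open>k\<close> on are unconstrained, so a
    single step sets them all.\<close>
  moreover have "par k (ILam (\<lambda>j. if j < k then z j else w j) u) (ILam z u)"
    by (rule par_lam) auto
  ultimately show ?thesis by (rule rtranclp.rtrancl_into_rtrancl)
qed

lemma pars_lam_inv: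
  "(par k)\<^sup>*\<^sup>* (ILam w u) X \<Longrightarrow> \<exists>w' u'. X = ILam w' u' \<and> (\<forall>j<k. (par k)\<^sup>*\<^sup>* (w j) (w' j))"
  by (induction rule: rtranclp_induct) (auto elim!: par_lamE intro: rtranclp.rtrancl_into_rtrancl)


section \<open>Equality of tower terms\<close>

definition joink :: "nat \<Rightarrow> 's itrm \<Rightarrow> 's itrm \<Rightarrow> bool" where
  "joink k X Y \<longleftrightarrow> (\<exists>Z. (par k)\<^sup>*\<^sup>* X Z \<and> (par k)\<^sup>*\<^sup>* Y Z)"

text \<open>The common reduct may depend on \<open>k\<close>. This makes equality a congruence under
  \<open>ILam\<close>, where infinitely many annotations have to be joined.\<close>

definition sim :: "'s itrm \<Rightarrow> 's itrm \<Rightarrow> bool" (infix "\<simeq>" 50) where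
  "X \<simeq> Y \<longleftrightarrow> (\<forall>k. joink k X Y)"

lemma joink_trans: "joink k X Y \<Longrightarrow> joink k Y Z \<Longrightarrow> joink k X Z"
  unfolding joink_def using confluentpD[OF par_confluent, of k] by (meson rtranclp_trans)

lemma joink_map:
  assumes "joink k X Y" and "\<And>X Y. par k X Y \<Longrightarrow> par k (f X) (f Y)"
  shows "joink k (f X) (f Y)"
  using assms pars_map[of k _ _ f] unfolding joink_def by blast

lemma sim_refl [simp]: "X \<simeq> X"
  by (auto simp: sim_def joink_def)

lemma sim_sym: "X \<simeq> Y \<Longrightarrow> Y \<simeq> X"
  by (auto simp: sim_def joink_def)

lemma sim_trans [trans]: "X \<simeq> Y \<Longrightarrow> Y \<simeq> Z \<Longrightarrow> X \<simeq> Z"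
  unfolding sim_def by (blast intro: joink_trans)

lemma sim_app: "v \<simeq> v' \<Longrightarrow> t \<simeq> t' \<Longrightarrow> IApp v t \<simeq> IApp v' t'"
  unfolding sim_def
  using joink_map[of _ v v' "\<lambda>v. IApp v t"] joink_map[of _ t t' "IApp v'"]
  by (metis joink_trans par_app par_refl)

lemma sim_lam:
  assumes "\<And>j. w j \<simeq> w' j" and "u \<simeq> u'"
  shows "ILam w u \<simeq> ILam w' u'"
  unfolding sim_def
proof
  fix k
  have "\<forall>j. \<exists>Z. (par k)\<^sup>*\<^sup>* (w j) Z \<and> (par k)\<^sup>*\<^sup>* (w' j) Z"
    using assms(1) by (simp add: sim_def joink_def)
  then obtain z where "\<And>j. (par k)\<^sup>*\<^sup>* (w j) (z j)" "\<And>j. (par k)\<^sup>*\<^sup>* (w' j) (z j)"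
    by metis
  then have "joink k (ILam w u) (ILam w' u)"
    unfolding joink_def by (blast intro: pars_annotation)
  moreover have "joink k (ILam w' u) (ILam w' u')"
    by (rule joink_map) (use assms(2) in \<open>auto simp: sim_def intro: par_lam\<close>)
  ultimately show "joink k (ILam w u) (ILam w' u')" by (rule joink_trans)
qed

lemma sim_isubst: "X \<simeq> Y \<Longrightarrow> isubst \<theta> X \<simeq> isubst \<theta> Y"
  unfolding sim_def using joink_map[of _ X Y "isubst \<theta>"] par_isubst[where \<theta> = \<theta> and \<theta>' = \<theta>] by auto

lemma sim_ren: "X \<simeq> Y \<Longrightarrow> ren \<xi> X \<simeq> ren \<xi> Y"
  by (simp add: ren_eq_isubst sim_isubst)

lemma sim_beta: "IApp v (ILam w u) \<simeq> isubst (case_nat v IVar) u"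
  unfolding sim_def joink_def by (blast intro: par_beta par_refl)

text \<open>Reducts of an abstraction are abstractions with annotations reduced level by level, so a
  common reduct also joins the annotations.\<close>

lemma sim_lam_inject:
  assumes "ILam w u \<simeq> ILam w' u'"
  shows "w j \<simeq> w' j"
  unfolding sim_def
proof
  fix k
  \<comment> \<open>Level \<open>j\<close> is tracked only below the bound; the result is then
    weakened to \<open>k\<close> by monotonicity.\<close>
  let ?K = "max k (Suc j)"
  obtain Z where Z: "(par ?K)\<^sup>*\<^sup>* (ILam w u) Z" "(par ?K)\<^sup>*\<^sup>* (ILam w' u') Z"
    using assms unfolding sim_def joink_def by blast
  obtain z t where z: "Z = ILam z t" "(par ?K)\<^sup>*\<^sup>* (w j) (z j)"
    using pars_lam_inv[OF Z(1)] by auto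
  have "(par ?K)\<^sup>*\<^sup>* (w' j) (z j)"
    using pars_lam_inv[OF Z(2)] z(1) by auto
  with z(2) show "joink k (w j) (w' j)"
    unfolding joink_def using pars_mono[of ?K _ _ k] by auto
qed


section \<open>Interpretation of terms as towers\<close>

definition push :: "(nat \<Rightarrow> 's itrm) \<Rightarrow> (nat \<Rightarrow> nat \<Rightarrow> 's itrm) \<Rightarrow> nat \<Rightarrow> nat \<Rightarrow> 's itrm" where
  "push w \<sigma> = case_nat (case_nat (IVar 0) (\<lambda>j. ren Suc (w j))) (\<lambda>x j. ren Suc (\<sigma> x j))"

text \<open>
  \<open>sem nxt T \<sigma> i\<close> is the \<open>i\<close>-th iterated type of \<open>T\<close>, with definitions unfolded, casts erased, and
  every abstraction annotated by the tower of all iterated types of its annotation.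
  A declared variable has itself at level \<open>0\<close> and the tower of its type above.
\<close>

primrec sem :: "('s \<Rightarrow> 's) \<Rightarrow> 's trm \<Rightarrow> (nat \<Rightarrow> nat \<Rightarrow> 's itrm) \<Rightarrow> nat \<Rightarrow> 's itrm" where
  "sem nxt (Sort s) \<sigma> = (\<lambda>i. ISort ((nxt ^^ i) s))"
| "sem nxt (Var x) \<sigma> = \<sigma> x"
| "sem nxt (App V T) \<sigma> = (\<lambda>i. IApp (sem nxt V \<sigma> 0) (sem nxt T \<sigma> i))"
| "sem nxt (Bind b V T) \<sigma> = (case b of
      Decl \<Rightarrow> (\<lambda>i. ILam (sem nxt V \<sigma>) (sem nxt T (push (sem nxt V \<sigma>) \<sigma>) i))
    | Defn \<Rightarrow> sem nxt T (case_nat (sem nxt V \<sigma>) \<sigma>))"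
| "sem nxt (Cast U T) \<sigma> = case_nat (sem nxt T \<sigma> 0) (sem nxt U \<sigma>)"

lemma isubst_sem: "isubst \<theta> (sem nxt T \<sigma> i) = sem nxt T (\<lambda>x j. isubst \<theta> (\<sigma> x j)) i"
proof (induction T arbitrary: \<theta> \<sigma> i)
  case (Bind b V T)
  show ?case
  proof (cases b)
    case Decl
    have "(\<lambda>x j. isubst (up \<theta>) (push (sem nxt V \<sigma>) \<sigma> x j))
        = push (sem nxt V (\<lambda>x j. isubst \<theta> (\<sigma> x j))) (\<lambda>x j. isubst \<theta> (\<sigma> x j))"
      by (auto simp: push_def isubst_up_ren Bind intro!: ext split: nat.split)
    then show ?thesis using Bind Decl by (simp add: fun_eq_iff)
  next
    case Defn
    have "(\<lambda>x j. isubst \<theta> (case_nat (sem nxt V \<sigma>) \<sigma> x j))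
        = case_nat (sem nxt V (\<lambda>x j. isubst \<theta> (\<sigma> x j))) (\<lambda>x j. isubst \<theta> (\<sigma> x j))"
      by (auto simp: Bind intro!: ext split: nat.split)
    then show ?thesis using Bind Defn by simp
  qed
qed (auto split: nat.split)

lemma ren_sem: "ren \<xi> (sem nxt T \<sigma> i) = sem nxt T (\<lambda>x j. ren \<xi> (\<sigma> x j)) i"
  by (simp add: ren_eq_isubst isubst_sem)

text \<open>The tower \<open>case_nat v w\<close> is that of the definition \<open>Cast W V\<close>
  created by a beta step: the argument at level \<open>0\<close>, the annotation above. Hence beta
  contraction of towers matches the beta step of terms.\<close>

lemma sem_beta:
  "isubst (case_nat v IVar) (sem nxt T (push w \<sigma>) i) = sem nxt T (case_nat (case_nat v w) \<sigma>) i"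
proof -
  have "(\<lambda>x j. isubst (case_nat v IVar) (push w \<sigma> x j)) = case_nat (case_nat v w) \<sigma>"
    by (auto simp: push_def intro!: ext split: nat.split)
  then show ?thesis by (simp add: isubst_sem)
qed

definition skip :: "nat \<Rightarrow> nat \<Rightarrow> nat" where
  "skip k x = (if x < k then x else Suc x)"

lemma skip_simps [simp]: "skip 0 = Suc" "skip (Suc k) 0 = 0" "skip (Suc k) (Suc x) = Suc (skip k x)"
  by (auto simp: skip_def)

lemma lift_Var [simp]: "lift k (Var x) = Var (skip k x)"
  by (simp add: skip_def)

declare lift.simps(2) [simp del]

lemma sem_lift: "sem nxt (lift k T) \<sigma> = sem nxt T (\<lambda>x. \<sigma> (skip k x))"
proof (induction T arbitrary: k \<sigma>)
  case (Bind b V T)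
  have "(\<lambda>x. push w \<sigma> (skip (Suc k) x)) = push w (\<lambda>x. \<sigma> (skip k x))" for w
    by (rule ext, case_tac x) (auto simp: push_def)
  moreover have "(\<lambda>x. case_nat w \<sigma> (skip (Suc k) x)) = case_nat w (\<lambda>x. \<sigma> (skip k x))" for w
    by (rule ext, case_tac x) auto
  ultimately show ?case using Bind by (cases b) auto
qed auto

lemma sem_lift_0 [simp]: "sem nxt (lift 0 T) \<sigma> = sem nxt T (\<lambda>x. \<sigma> (Suc x))"
  by (simp add: sem_lift)

lemma sem_cong: "(\<And>x j. \<sigma> x j \<simeq> \<sigma>' x j) \<Longrightarrow> sem nxt T \<sigma> i \<simeq> sem nxt T \<sigma>' i"
proof (induction T arbitrary: \<sigma> \<sigma>' i)
  case (Bind b V T)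
  have V: "sem nxt V \<sigma> j \<simeq> sem nxt V \<sigma>' j" for j using Bind by blast
  show ?case
  proof (cases b)
    case Decl
    have "push (sem nxt V \<sigma>) \<sigma> x j \<simeq> push (sem nxt V \<sigma>') \<sigma>' x j" for x j
      using V Bind(3) by (auto simp: push_def sim_ren split: nat.split)
    then show ?thesis using Decl V Bind(2) by (auto intro!: sim_lam)
  next
    case Defn
    have "case_nat (sem nxt V \<sigma>) \<sigma> x j \<simeq> case_nat (sem nxt V \<sigma>') \<sigma>' x j" for x j
      using V Bind(3) by (auto split: nat.split)
    then show ?thesis using Defn Bind(2) by auto
  qed
qed (auto intro: sim_app split: nat.split)

section \<open>Valuations compatible with an environment\<close>

text \<open>Level \<open>0\<close> of a declared variable is left free; this allows the argument of
  a beta redex to be put there.\<close>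

fun compat :: "('s \<Rightarrow> 's) \<Rightarrow> 's env \<Rightarrow> (nat \<Rightarrow> nat \<Rightarrow> 's itrm) \<Rightarrow> bool" where
  "compat nxt [] \<sigma> \<longleftrightarrow> True"
| "compat nxt ((Decl, W) # K) \<sigma> \<longleftrightarrow> compat nxt K (\<lambda>x. \<sigma> (Suc x)) \<and>
    (\<forall>i. \<sigma> 0 (Suc i) \<simeq> sem nxt W (\<lambda>x. \<sigma> (Suc x)) i)"
| "compat nxt ((Defn, V) # K) \<sigma> \<longleftrightarrow> compat nxt K (\<lambda>x. \<sigma> (Suc x)) \<and>
    (\<forall>i. \<sigma> 0 i \<simeq> sem nxt V (\<lambda>x. \<sigma> (Suc x)) i)"

lemma compat_tail: "compat nxt ((b, V) # K) \<sigma> \<Longrightarrow> compat nxt K (\<lambda>x. \<sigma> (Suc x))"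
  by (cases b) auto

lemma compat_ren: "compat nxt L \<sigma> \<Longrightarrow> compat nxt L (\<lambda>x j. ren \<xi> (\<sigma> x j))"
  by (induction nxt L \<sigma> rule: compat.induct) (auto simp: ren_sem[symmetric] sim_ren)

lemma compat_push: "compat nxt L \<sigma> \<Longrightarrow> compat nxt ((Decl, V) # L) (push (sem nxt V \<sigma>) \<sigma>)"
  using compat_ren[of nxt L \<sigma> Suc] by (auto simp: push_def ren_sem)

lemma compat_case_nat: "compat nxt L \<sigma> \<Longrightarrow> compat nxt ((Defn, V) # L) (case_nat (sem nxt V \<sigma>) \<sigma>)"
  by auto

lemma compat_replace:
  assumes "\<And>\<sigma> i. compat nxt L \<sigma> \<Longrightarrow> sem nxt V' \<sigma> i \<simeq> sem nxt V \<sigma> i"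
    and "compat nxt ((b, V') # L) \<sigma>"
  shows "compat nxt ((b, V) # L) \<sigma>"
  using assms by (cases b) (auto intro: sim_trans)


section \<open>Insertion of an entry into an environment\<close>

inductive ins :: "nat \<Rightarrow> 's env \<Rightarrow> 's env \<Rightarrow> bool" where
  ins_0: "ins 0 L ((b, V) # L)"
| ins_Suc: "ins k L L' \<Longrightarrow> ins (Suc k) ((b, V) # L) ((b, lift k V) # L')"

lemma compat_weaken: "ins k L L' \<Longrightarrow> compat nxt L' \<sigma> \<Longrightarrow> compat nxt L (\<lambda>x. \<sigma> (skip k x))"
proof (induction arbitrary: \<sigma> rule: ins.induct)
  case (ins_0 L b V)
  then show ?case by (auto dest: compat_tail)
next
  case (ins_Suc k L L' b V)
  then show ?case by (cases b) (auto simp: sem_lift)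
qed

text \<open>The conditions in semantic validity range over all compatible valuations. Strengthening
  therefore needs every valuation of the smaller environment to be a restriction of one of the
  larger.\<close>

lemma compat_extend:
  "ins k L L' \<Longrightarrow> compat nxt L \<sigma> \<Longrightarrow> \<exists>\<sigma>'. compat nxt L' \<sigma>' \<and> (\<lambda>x. \<sigma>' (skip k x)) = \<sigma>"
proof (induction arbitrary: \<sigma> rule: ins.induct)
  case (ins_0 L b V)
  show ?case
  proof (cases b)
    case Decl
    with ins_0 show ?thesis
      \<comment> \<open>Compatibility forces the levels above \<open>0\<close>;
        \<open>IVar 0\<close> is an arbitrary filler.\<close>
      by (intro exI[of _ "case_nat (case_nat (IVar 0) (sem nxt V \<sigma>)) \<sigma>"]) auto
  next
    case Defn
    with ins_0 show ?thesis by (intro exI[of _ "case_nat (sem nxt V \<sigma>) \<sigma>"]) auto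
  qed
next
  case (ins_Suc k L L' b V)
  then obtain \<sigma>' where "compat nxt L' \<sigma>'" "(\<lambda>x. \<sigma>' (skip k x)) = (\<lambda>x. \<sigma> (Suc x))"
    using compat_tail by blast
  moreover from this have "(\<lambda>x. case_nat (\<sigma> 0) \<sigma>' (skip (Suc k) x)) = \<sigma>"
    by (intro ext, case_tac x) (auto dest: fun_cong)
  ultimately show ?case using ins_Suc.prems
    by (intro exI[of _ "case_nat (\<sigma> 0) \<sigma>'"]) (cases b; auto simp: sem_lift)
qed


section \<open>Semantic validity\<close>

text \<open>The reductions in the rules of \<open>valid\<close> are replaced by equality of towers.
  In \<open>sv_app\<close> one tower \<open>w\<close> annotates all levels from \<open>n\<close> on,
  so the condition survives a shift of the tower of \<open>T\<close>.\<close>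

inductive sv :: "('s \<Rightarrow> 's) \<Rightarrow> 's env \<Rightarrow> 's trm \<Rightarrow> bool" for nxt where
  sv_sort: "sv nxt L (Sort s)"
| sv_var_0: "sv nxt K V \<Longrightarrow> sv nxt ((b, V) # K) (Var 0)"
| sv_var_Suc: "sv nxt K (Var i) \<Longrightarrow> sv nxt ((b, V) # K) (Var (Suc i))"
| sv_bind: "sv nxt L V \<Longrightarrow> sv nxt ((b, V) # L) T \<Longrightarrow> sv nxt L (Bind b V T)"
| sv_cast: "sv nxt L U \<Longrightarrow> sv nxt L T \<Longrightarrow>
    (\<And>\<sigma> i. compat nxt L \<sigma> \<Longrightarrow> sem nxt U \<sigma> i \<simeq> sem nxt T \<sigma> (Suc i)) \<Longrightarrow> sv nxt L (Cast U T)"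
| sv_app: "sv nxt L V \<Longrightarrow> sv nxt L T \<Longrightarrow>
    (\<And>\<sigma>. compat nxt L \<sigma> \<Longrightarrow> \<exists>n w. (\<forall>i\<ge>n. \<exists>u. sem nxt T \<sigma> i \<simeq> ILam w u) \<and>
      (\<forall>j. w j \<simeq> sem nxt V \<sigma> (Suc j))) \<Longrightarrow> sv nxt L (App V T)"

inductive_cases sv_var_0E: "sv nxt ((b, V) # K) (Var 0)"
inductive_cases sv_var_SucE: "sv nxt ((b, V) # K) (Var (Suc i))"
inductive_cases sv_bindE: "sv nxt L (Bind b V T)"
inductive_cases sv_castE: "sv nxt L (Cast U T)"
inductive_cases sv_appE: "sv nxt L (App V T)"

lemma sv_cast_sim:
  "sv nxt L (Cast U T) \<Longrightarrow> compat nxt L \<sigma> \<Longrightarrow> sem nxt U \<sigma> i \<simeq> sem nxt T \<sigma> (Suc i)"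
  by (auto elim: sv_castE)

lemma sv_weaken: "sv nxt L T \<Longrightarrow> ins k L L' \<Longrightarrow> sv nxt L' (lift k T)"
proof (induction arbitrary: k L' rule: sv.induct)
  case (sv_var_0 K V b)
  from sv_var_0.prems show ?case
    by cases (use sv_var_0 in \<open>auto intro: sv.intros\<close>)
next
  case (sv_var_Suc K i b V)
  from sv_var_Suc.prems show ?case
    by cases (use sv_var_Suc in \<open>auto intro: sv.intros\<close>)
next
  case (sv_bind L V b T)
  show ?case
    using sv_bind.IH(1)[OF sv_bind.prems] sv_bind.IH(2)[OF ins_Suc[OF sv_bind.prems]]
    by (simp add: sv.sv_bind)
next
  case (sv_cast L U T)
  then show ?case by (auto simp: sem_lift intro!: sv.intros dest: compat_weaken)
next
  case (sv_app L V T)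
  then show ?case by (auto simp: sem_lift intro!: sv.intros dest: compat_weaken)
qed (auto intro: sv.intros ins.intros)

text \<open>This serves the step that drops a definition whose variable does not occur.\<close>

lemma sv_strengthen: "sv nxt L' T' \<Longrightarrow> T' = lift k T \<Longrightarrow> ins k L L' \<Longrightarrow> sv nxt L T"
proof (induction arbitrary: k L T rule: sv.induct)
  case (sv_sort L s)
  then show ?case by (cases T) (auto intro: sv.intros)
next
  case (sv_var_0 K V b)
  then obtain x where T: "T = Var x" and x: "skip k x = 0" by (cases T) auto
  then have x: "x = 0" by (cases k; cases x) auto
  with sv_var_0.prems T obtain k0 L0 V0 where "k = Suc k0" and L: "L = (b, V0) # L0"
    and V0: "V = lift k0 V0" "ins k0 L0 K"
    by (auto elim: ins.cases)
  show ?case unfolding T L x by (intro sv.sv_var_0 sv_var_0.IH[OF V0])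
next
  case (sv_var_Suc K i b V)
  then obtain x where T: "T = Var x" and x: "skip k x = Suc i" by (cases T) auto
  from sv_var_Suc.prems(2) show ?case
  proof cases
    case ins_0
    with sv_var_Suc.hyps T x show ?thesis by simp
  next
    case (ins_Suc k0 L0 V0)
    with x obtain y where y: "x = Suc y" "skip k0 y = i" by (cases x) auto
    have "sv nxt L0 (Var y)"
      by (rule sv_var_Suc.IH[OF _ ins_Suc(4)]) (simp add: y)
    then show ?thesis unfolding T y ins_Suc(2) by (rule sv.sv_var_Suc)
  qed
next
  case (sv_bind L' V' b T')
  then obtain V0 T0 where T: "T = Bind b V0 T0" and eq: "V' = lift k V0" "T' = lift (Suc k) T0"
    by (cases T) auto
  have "ins (Suc k) ((b, V0) # L) ((b, V') # L')"
    unfolding eq by (rule ins_Suc[OF sv_bind.prems(2)])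
  then show ?case
    unfolding T using sv_bind.IH(1)[OF eq(1) sv_bind.prems(2)] sv_bind.IH(2)[OF eq(2)]
    by (intro sv.sv_bind)
next
  case (sv_cast L' U' T')
  then obtain U0 T0 where T: "T = Cast U0 T0" and eq: "U' = lift k U0" "T' = lift k T0"
    by (cases T) auto
  have "sem nxt U0 \<sigma> i \<simeq> sem nxt T0 \<sigma> (Suc i)" if \<sigma>: "compat nxt L \<sigma>" for \<sigma> i
  proof -
    obtain \<sigma>' where \<sigma>': "compat nxt L' \<sigma>'" "(\<lambda>x. \<sigma>' (skip k x)) = \<sigma>"
      using compat_extend[OF sv_cast.prems(2) \<sigma>] by blast
    show ?thesis using sv_cast.hyps(3)[OF \<sigma>'(1)] unfolding eq sem_lift \<sigma>'(2) .
  qed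
  then show ?case
    unfolding T using sv_cast.IH(1)[OF eq(1) sv_cast.prems(2)] sv_cast.IH(2)[OF eq(2) sv_cast.prems(2)]
    by (intro sv.sv_cast)
next
  case (sv_app L' V' T')
  then obtain V0 T0 where T: "T = App V0 T0" and eq: "V' = lift k V0" "T' = lift k T0"
    by (cases T) auto
  have "\<exists>n w. (\<forall>i\<ge>n. \<exists>u. sem nxt T0 \<sigma> i \<simeq> ILam w u) \<and> (\<forall>j. w j \<simeq> sem nxt V0 \<sigma> (Suc j))"
    if \<sigma>: "compat nxt L \<sigma>" for \<sigma>
  proof -
    obtain \<sigma>' where \<sigma>': "compat nxt L' \<sigma>'" "(\<lambda>x. \<sigma>' (skip k x)) = \<sigma>"
      using compat_extend[OF sv_app.prems(2) \<sigma>] by blast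
    show ?thesis using sv_app.hyps(3)[OF \<sigma>'(1)] unfolding eq sem_lift \<sigma>'(2) .
  qed
  then show ?case
    unfolding T using sv_app.IH(1)[OF eq(1) sv_app.prems(2)] sv_app.IH(2)[OF eq(2) sv_app.prems(2)]
    by (intro sv.sv_app)
qed

section \<open>Refinement of environments\<close>

text \<open>The new entries admit no new valuations, so semantic conditions persist. This covers
  both the reduction of an entry and the passage from a declaration to a definition in a beta
  step.\<close>

inductive refine :: "('s \<Rightarrow> 's) \<Rightarrow> 's env \<Rightarrow> 's env \<Rightarrow> bool" for nxt where
  refine_refl: "refine nxt L L"
| refine_Cons: "refine nxt L L' \<Longrightarrow> sv nxt L' V' \<Longrightarrow>
    (\<And>\<sigma>. compat nxt ((b', V') # L') \<sigma> \<Longrightarrow> compat nxt ((b, V) # L) \<sigma>) \<Longrightarrow>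
    refine nxt ((b, V) # L) ((b', V') # L')"

lemma compat_refine: "refine nxt L L' \<Longrightarrow> compat nxt L' \<sigma> \<Longrightarrow> compat nxt L \<sigma>"
  by (induction rule: refine.induct) auto

lemma sv_refine: "sv nxt L T \<Longrightarrow> refine nxt L L' \<Longrightarrow> sv nxt L' T"
proof (induction arbitrary: L' rule: sv.induct)
  case (sv_var_0 K V b)
  from sv_var_0.prems show ?case
    by cases (use sv_var_0 in \<open>auto intro: sv.intros\<close>)
next
  case (sv_var_Suc K i b V)
  from sv_var_Suc.prems show ?case
    by cases (use sv_var_Suc in \<open>auto intro: sv.intros\<close>)
next
  case (sv_bind L V b T)
  have V: "sv nxt L' V" by (rule sv_bind.IH(1)[OF sv_bind.prems])
  have "compat nxt ((b, V) # L) \<sigma>" if "compat nxt ((b, V) # L') \<sigma>" for \<sigma>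
    using that compat_refine[OF sv_bind.prems] by (cases b) auto
  then have "refine nxt ((b, V) # L) ((b, V) # L')"
    by (rule refine_Cons[OF sv_bind.prems V])
  then show ?case using V sv_bind.IH(2) by (intro sv.sv_bind)
next
  case (sv_cast L U T)
  then show ?case by (auto intro!: sv.intros dest: compat_refine)
next
  case (sv_app L V T)
  then show ?case by (auto intro!: sv.intros dest: compat_refine)
qed (auto intro: sv.intros)

section \<open>Reduction preserves semantic validity and shifts towers\<close>

text \<open>Both claims go into one induction: the shift for the reduced subterm re-establishes the
  semantic conditions at the enclosing application or cast.\<close>

lemma rt_step_sem:
  "rt_step nxt L n T T' \<Longrightarrow> sv nxt L T \<Longrightarrow>
    sv nxt L T' \<and> (\<forall>\<sigma> i. compat nxt L \<sigma> \<longrightarrow> sem nxt T' \<sigma> i \<simeq> sem nxt T \<sigma> (n + i))"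
proof (induction rule: rt_step.induct)
  case (beta L V W T)
  from beta have V: "sv nxt L V" and W: "sv nxt L W" and T: "sv nxt ((Decl, W) # L) T"
    and *: "\<And>\<sigma>. compat nxt L \<sigma> \<Longrightarrow> \<exists>n w. (\<forall>i\<ge>n. \<exists>u. sem nxt (Lam W T) \<sigma> i \<simeq> ILam w u) \<and>
      (\<forall>j. w j \<simeq> sem nxt V \<sigma> (Suc j))"
    by (auto elim!: sv_appE sv_bindE)
  have "sem nxt W \<sigma> i \<simeq> sem nxt V \<sigma> (Suc i)" if \<sigma>: "compat nxt L \<sigma>" for \<sigma> i
  proof -
    \<comment> \<open>Every level of \<open>Lam W T\<close> is annotated by the whole tower of
      \<open>W\<close>, so injectivity at the single level \<open>n\<close> identifies it with
      \<open>w\<close>, the tower of types of \<open>V\<close>.\<close>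
    obtain n w u where "sem nxt (Lam W T) \<sigma> n \<simeq> ILam w u" "w i \<simeq> sem nxt V \<sigma> (Suc i)"
      using *[OF \<sigma>] by blast
    then show ?thesis by (auto intro: sim_trans dest: sim_lam_inject)
  qed
  then have C: "sv nxt L (Cast W V)" using V W by (auto intro: sv.intros)
  \<comment> \<open>Above level \<open>0\<close> the tower of \<open>Cast W V\<close> is that of
    \<open>W\<close>, as a declaration of type \<open>W\<close> demands.\<close>
  have "refine nxt ((Decl, W) # L) ((Defn, Cast W V) # L)"
    using C by (auto intro!: refine.intros) (metis nat.case(2))
  then have "sv nxt ((Defn, Cast W V) # L) T" by (rule sv_refine[OF T])
  then show ?case using C by (auto intro!: sv.intros sim_sym[OF sim_beta[THEN sim_trans]] simp: sem_beta)
next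
  case (defn V K)
  then show ?case by (auto elim!: sv_var_0E intro: sv_weaken ins.intros sim_sym)
next
  case (drop L V T)
  then show ?case by (auto elim!: sv_bindE intro: sv_strengthen ins.intros)
next
  case (swap L V W T)
  from swap have V: "sv nxt L V" and W: "sv nxt L W" and T: "sv nxt ((Defn, W) # L) T"
    and *: "\<And>\<sigma>. compat nxt L \<sigma> \<Longrightarrow> \<exists>n w. (\<forall>i\<ge>n. \<exists>u. sem nxt (Def W T) \<sigma> i \<simeq> ILam w u) \<and>
      (\<forall>j. w j \<simeq> sem nxt V \<sigma> (Suc j))"
    by (auto elim!: sv_appE sv_bindE)
  have "sv nxt ((Defn, W) # L) (App (lift 0 V) T)"
  proof (rule sv_app)
    fix \<sigma> assume \<sigma>: "compat nxt ((Defn, W) # L) \<sigma>"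
    let ?\<sigma> = "\<lambda>x. \<sigma> (Suc x)"
    \<comment> \<open>Compatibility makes the value of the defined variable equal to the tower of
      \<open>W\<close>, which \<open>Def W T\<close> substitutes for it.\<close>
    have "sem nxt T \<sigma> i \<simeq> sem nxt (Def W T) ?\<sigma> i" for i
      using \<sigma> by (auto intro!: sem_cong split: nat.split)
    moreover obtain n w where "\<forall>i\<ge>n. \<exists>u. sem nxt (Def W T) ?\<sigma> i \<simeq> ILam w u"
        "\<forall>j. w j \<simeq> sem nxt V ?\<sigma> (Suc j)"
      using *[of ?\<sigma>] \<sigma> by auto
    ultimately show "\<exists>n w. (\<forall>i\<ge>n. \<exists>u. sem nxt T \<sigma> i \<simeq> ILam w u) \<and>
        (\<forall>j. w j \<simeq> sem nxt (lift 0 V) \<sigma> (Suc j))"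
      unfolding sem_lift_0 by (meson sim_trans)
  qed (use V T in \<open>auto intro: sv_weaken ins.intros\<close>)
  then show ?case using W by (auto intro: sv.intros)
next
  case (uncast L U T)
  \<comment> \<open>Level \<open>0\<close> of a cast is that of \<open>T\<close>; level
    \<open>Suc i\<close> is level \<open>i\<close> of \<open>U\<close>, which semantic validity
    equates with level \<open>Suc i\<close> of \<open>T\<close>.\<close>
  have "sem nxt T \<sigma> i \<simeq> sem nxt (Cast U T) \<sigma> i" if "compat nxt L \<sigma>" for \<sigma> i
    using uncast that by (cases i) (auto elim!: sv_castE intro: sim_sym)
  then show ?case using uncast by (auto elim: sv_castE)
next
  case (sort L s)
  then show ?case by (auto intro: sv.intros simp: funpow_swap1)
next
  case (decl W K)
  then show ?case by (auto elim!: sv_var_0E intro: sv_weaken ins.intros sim_sym)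
next
  case (cast_type L U T)
  then show ?case by (auto elim!: sv_castE)
next
  case (weak K n i T b V)
  then have "sv nxt K (Var i)" by (auto elim: sv_var_SucE)
  with weak.IH show ?case by (auto intro: sv_weaken ins.intros dest: compat_tail)
next
  case (app_arg L V1 V2 T)
  from app_arg.prems have V1: "sv nxt L V1" and T: "sv nxt L T"
    and *: "\<And>\<sigma>. compat nxt L \<sigma> \<Longrightarrow> \<exists>n w. (\<forall>i\<ge>n. \<exists>u. sem nxt T \<sigma> i \<simeq> ILam w u) \<and>
      (\<forall>j. w j \<simeq> sem nxt V1 \<sigma> (Suc j))"
    by (auto elim!: sv_appE)
  have V2: "sv nxt L V2" "\<And>\<sigma> i. compat nxt L \<sigma> \<Longrightarrow> sem nxt V2 \<sigma> i \<simeq> sem nxt V1 \<sigma> i"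
    using app_arg.IH[OF V1] by auto
  have "sv nxt L (App V2 T)"
    by (rule sv_app[OF V2(1) T]) (meson * V2(2) sim_sym sim_trans)
  then show ?case using V2 by (auto intro!: sim_app)
next
  case (app_fun L n T1 T2 V)
  from app_fun.prems have V: "sv nxt L V" and T1: "sv nxt L T1"
    and *: "\<And>\<sigma>. compat nxt L \<sigma> \<Longrightarrow> \<exists>n w. (\<forall>i\<ge>n. \<exists>u. sem nxt T1 \<sigma> i \<simeq> ILam w u) \<and>
      (\<forall>j. w j \<simeq> sem nxt V \<sigma> (Suc j))"
    by (auto elim!: sv_appE)
  have T2: "sv nxt L T2" "\<And>\<sigma> i. compat nxt L \<sigma> \<Longrightarrow> sem nxt T2 \<sigma> i \<simeq> sem nxt T1 \<sigma> (n + i)"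
    using app_fun.IH[OF T1] by auto
  have "sv nxt L (App V T2)"
    \<comment> \<open>The threshold for \<open>T1\<close> also works for \<open>T2\<close>, because
      adding the degree only raises levels.\<close>
    by (rule sv_app[OF V T2(1)]) (meson * T2(2) sim_trans trans_le_add2)
  then show ?case using T2 by (auto intro!: sim_app)
next
  case (bind_ann L V1 V2 b T)
  from bind_ann.prems have V1: "sv nxt L V1" and T: "sv nxt ((b, V1) # L) T"
    by (auto elim!: sv_bindE)
  have V2: "sv nxt L V2" "\<And>\<sigma> i. compat nxt L \<sigma> \<Longrightarrow> sem nxt V2 \<sigma> i \<simeq> sem nxt V1 \<sigma> i"
    using bind_ann.IH[OF V1] by auto
  have "refine nxt ((b, V1) # L) ((b, V2) # L)"
    by (rule refine_Cons[OF refine_refl V2(1)]) (rule compat_replace[OF V2(2)])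
  then have "sv nxt L (Bind b V2 T)"
    using V2(1) T by (auto intro: sv.intros sv_refine)
  moreover have "sem nxt (Bind b V2 T) \<sigma> i \<simeq> sem nxt (Bind b V1 T) \<sigma> i" if "compat nxt L \<sigma>" for \<sigma> i
    using V2(2)[OF that]
    by (cases b) (auto intro!: sim_lam sem_cong simp: push_def sim_ren split: nat.split)
  ultimately show ?case by simp
next
  case (bind_body b V L n T1 T2)
  from bind_body.prems have V: "sv nxt L V" and T1: "sv nxt ((b, V) # L) T1"
    by (auto elim!: sv_bindE)
  have T2: "sv nxt ((b, V) # L) T2"
    "\<And>\<sigma> i. compat nxt ((b, V) # L) \<sigma> \<Longrightarrow> sem nxt T2 \<sigma> i \<simeq> sem nxt T1 \<sigma> (n + i)"
    using bind_body.IH[OF T1] by auto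
  have "sem nxt (Bind b V T2) \<sigma> i \<simeq> sem nxt (Bind b V T1) \<sigma> (n + i)" if "compat nxt L \<sigma>" for \<sigma> i
    using T2(2) compat_push[OF that] compat_case_nat[OF that] by (cases b) (auto intro!: sim_lam)
  then show ?case using V T2(1) by (auto intro: sv.intros)
next
  case (cast_left L U1 U2 T)
  from cast_left.prems have U1: "sv nxt L U1" and T: "sv nxt L T"
    and *: "\<And>\<sigma> i. compat nxt L \<sigma> \<Longrightarrow> sem nxt U1 \<sigma> i \<simeq> sem nxt T \<sigma> (Suc i)"
    by (auto elim!: sv_castE)
  have U2: "sv nxt L U2" "\<And>\<sigma> i. compat nxt L \<sigma> \<Longrightarrow> sem nxt U2 \<sigma> i \<simeq> sem nxt U1 \<sigma> i"
    using cast_left.IH[OF U1] by auto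
  have "sv nxt L (Cast U2 T)"
    by (rule sv_cast[OF U2(1) T]) (meson * U2(2) sim_trans)
  then show ?case using U2 by (auto split: nat.split)
next
  case (cast_right L T1 T2 U)
  from cast_right.prems have U: "sv nxt L U" and T1: "sv nxt L T1"
    and *: "\<And>\<sigma> i. compat nxt L \<sigma> \<Longrightarrow> sem nxt U \<sigma> i \<simeq> sem nxt T1 \<sigma> (Suc i)"
    by (auto elim!: sv_castE)
  have T2: "sv nxt L T2" "\<And>\<sigma> i. compat nxt L \<sigma> \<Longrightarrow> sem nxt T2 \<sigma> i \<simeq> sem nxt T1 \<sigma> i"
    using cast_right.IH[OF T1] by auto
  have "sv nxt L (Cast U T2)"
    by (rule sv_cast[OF U T2(1)]) (meson * T2(2) sim_sym sim_trans)
  then show ?case using T2 by (auto split: nat.split)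
next
  case (cast_both L U1 U2 T1 T2)
  from cast_both.prems have U1: "sv nxt L U1" and T1: "sv nxt L T1"
    and *: "\<And>\<sigma> i. compat nxt L \<sigma> \<Longrightarrow> sem nxt U1 \<sigma> i \<simeq> sem nxt T1 \<sigma> (Suc i)"
    by (auto elim!: sv_castE)
  have U2: "sv nxt L U2" "\<And>\<sigma> i. compat nxt L \<sigma> \<Longrightarrow> sem nxt U2 \<sigma> i \<simeq> sem nxt U1 \<sigma> (Suc i)"
    using cast_both.IH(1)[OF U1] by auto
  have T2: "sv nxt L T2" "\<And>\<sigma> i. compat nxt L \<sigma> \<Longrightarrow> sem nxt T2 \<sigma> i \<simeq> sem nxt T1 \<sigma> (Suc i)"
    using cast_both.IH(2)[OF T1] by auto
  have "sv nxt L (Cast U2 T2)"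
    by (rule sv_cast[OF U2(1) T2(1)]) (meson * U2(2) T2(2) sim_sym sim_trans)
  \<comment> \<open>At level \<open>0\<close> the shift crosses from one component of the cast to
    the other: \<open>T2\<close> at \<open>0\<close> is \<open>T1\<close> at \<open>1\<close>, which
    is \<open>U1\<close> at \<open>0\<close>.\<close>
  moreover have "sem nxt T2 \<sigma> 0 \<simeq> sem nxt U1 \<sigma> 0" if "compat nxt L \<sigma>" for \<sigma>
    using T2(2)[OF that, of 0] *[OF that, of 0] by (auto intro: sim_trans sim_sym)
  ultimately show ?case using U2(2) by (auto split: nat.split)
qed

lemma rt_steps_sem:
  "rt_steps nxt L n T T' \<Longrightarrow> sv nxt L T \<Longrightarrow>
    sv nxt L T' \<and> (\<forall>\<sigma> i. compat nxt L \<sigma> \<longrightarrow> sem nxt T' \<sigma> i \<simeq> sem nxt T \<sigma> (n + i))"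
proof (induction rule: rt_steps.induct)
  case (single n T1 T2)
  then show ?case by (rule rt_step_sem)
next
  case (trans n1 T1 T n2 T2)
  then show ?case by (metis (no_types, lifting) add.assoc sim_trans)
qed auto

lemma valid_imp_sv: "valid nxt A L T \<Longrightarrow> sv nxt L T"
proof (induction rule: valid.induct)
  case (cast L U T U0)
  then have "sem nxt U0 \<sigma> i \<simeq> sem nxt T \<sigma> (Suc i)" "sem nxt U0 \<sigma> i \<simeq> sem nxt U \<sigma> i"
    if "compat nxt L \<sigma>" for \<sigma> i
    using that rt_steps_sem[of nxt L 1 T U0] rt_steps_sem[of nxt L 0 U U0] by auto
  then show ?case using cast by (blast intro: sv.intros sim_trans sim_sym)
next
  case (app L V T n W0 U0)
  \<comment> \<open>The reduction of degree \<open>n\<close> from \<open>T\<close> to an abstraction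
    exhibits all levels of \<open>T\<close> from \<open>n\<close> on as abstractions annotated by
    the tower of \<open>W0\<close>.\<close>
  have T: "ILam (sem nxt W0 \<sigma>) (sem nxt U0 (push (sem nxt W0 \<sigma>) \<sigma>) i) \<simeq> sem nxt T \<sigma> (n + i)"
    if "compat nxt L \<sigma>" for \<sigma> i
    using that rt_steps_sem[OF app.hyps(4) app.IH(2)] by fastforce
  have V: "sem nxt W0 \<sigma> j \<simeq> sem nxt V \<sigma> (Suc j)" if "compat nxt L \<sigma>" for \<sigma> j
    using that rt_steps_sem[OF app.hyps(5) app.IH(1)] by simp
  show ?case
  proof (rule sv_app[OF app.IH])
    fix \<sigma> assume \<sigma>: "compat nxt L \<sigma>"
    have "\<exists>u. sem nxt T \<sigma> i \<simeq> ILam (sem nxt W0 \<sigma>) u" if "i \<ge> n" for i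
      using sim_sym[OF T[OF \<sigma>, of "i - n"]] that by auto
    with V[OF \<sigma>] show "\<exists>n w. (\<forall>i\<ge>n. \<exists>u. sem nxt T \<sigma> i \<simeq> ILam w u) \<and>
        (\<forall>j. w j \<simeq> sem nxt V \<sigma> (Suc j))"
      by blast
  qed
qed (auto intro: sv.intros)


section \<open>Reading back\<close>

primrec readback :: "'s itrm \<Rightarrow> 's trm" where
  "readback (ISort s) = Sort s"
| "readback (IVar x) = Var x"
| "readback (IApp v t) = App (readback v) (readback t)"
| "readback (ILam w u) = Lam (readback (w 0)) (readback u)"

lemma readback_ren: "readback (ren (skip k) X) = lift k (readback X)"
proof (induction X arbitrary: k)
  case (ILam w u)
  have "case_nat 0 (\<lambda>x. Suc (skip k x)) = skip (Suc k)"
    by (rule ext, case_tac x) auto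
  then show ?case using ILam by simp
qed auto

lemma readback_ren_Suc [simp]: "readback (ren Suc X) = lift 0 (readback X)"
  using readback_ren[of 0] by simp

lemma lift_lift: "l \<le> k \<Longrightarrow> lift l (lift k T) = lift (Suc k) (lift l T)"
  by (induction T arbitrary: k l) (auto simp: skip_def)

section \<open>Degree-zero reduction as a congruence\<close>

lemma rt_step_weaken:
  "rt_step nxt L n T T' \<Longrightarrow> ins k L L' \<Longrightarrow> rt_step nxt L' n (lift k T) (lift k T')"
proof (induction arbitrary: k L' rule: rt_step.induct)
  case (defn V K)
  from defn show ?case
    by cases (use rt_step.weak[OF rt_step.defn] in
      \<open>auto simp: lift_lift[of 0, symmetric] intro: rt_step.intros\<close>)
next
  case (decl W K)
  from decl show ?case
    by cases (use rt_step.weak[OF rt_step.decl] rt_step.decl in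
      \<open>auto simp: lift_lift[of 0, symmetric] intro: rt_step.intros\<close>)
next
  case (weak K n i T b V)
  from weak.prems show ?case
    by cases (use weak in \<open>auto simp: lift_lift[of 0, symmetric] intro!: rt_step.weak\<close>)
qed (auto simp: lift_lift[of 0, symmetric] intro: rt_step.intros[simplified] ins.intros)

lemma rt_steps_0_induct [consumes 1, case_names refl step]:
  assumes "rt_steps nxt L 0 T T'" and "P T"
    and "\<And>T1 T2. P T1 \<Longrightarrow> rt_step nxt L 0 T1 T2 \<Longrightarrow> P T2"
  shows "P T'"
proof -
  have "rt_steps nxt L n T T' \<Longrightarrow> n = 0 \<Longrightarrow> P T \<Longrightarrow> P T'" for n T T'
    by (induction rule: rt_steps.induct) (auto intro: assms(3))
  then show ?thesis using assms(1,2) by blast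
qed

lemma rt_steps_0_trans [trans]:
  "rt_steps nxt L 0 T1 T2 \<Longrightarrow> rt_steps nxt L 0 T2 T3 \<Longrightarrow> rt_steps nxt L 0 T1 T3"
  using rt_steps.trans[of nxt L 0 T1 T2 0 T3] by simp

lemma rt_steps_0_map:
  assumes "rt_steps nxt L 0 T T'"
    and "\<And>T T'. rt_step nxt L 0 T T' \<Longrightarrow> rt_step nxt L' 0 (f T) (f T')"
  shows "rt_steps nxt L' 0 (f T) (f T')"
  using assms(1)
  by (induction rule: rt_steps_0_induct)
    (auto intro: rt_steps.refl rt_steps_0_trans rt_steps.single assms(2))

lemma rt_steps_0_weaken: "rt_steps nxt L 0 T T' \<Longrightarrow> rt_steps nxt ((b, V) # L) 0 (lift 0 T) (lift 0 T')"
  by (erule rt_steps_0_map) (auto intro: rt_step_weaken ins.intros)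

lemma rt_steps_0_app:
  "rt_steps nxt L 0 V V' \<Longrightarrow> rt_steps nxt L 0 T T' \<Longrightarrow> rt_steps nxt L 0 (App V T) (App V' T')"
  using rt_steps_0_map[where f = "\<lambda>V. App V T"] rt_steps_0_map[where f = "App V'"]
  by (metis (no_types, lifting) rt_step.app_arg rt_step.app_fun rt_steps_0_trans)

lemma rt_steps_0_bind:
  "rt_steps nxt L 0 V V' \<Longrightarrow> rt_steps nxt ((b, V) # L) 0 T T' \<Longrightarrow>
    rt_steps nxt L 0 (Bind b V T) (Bind b V' T')"
  using rt_steps_0_map[where f = "\<lambda>V. Bind b V T'"] rt_steps_0_map[where f = "Bind b V"]
  by (metis (no_types, lifting) rt_step.bind_ann rt_step.bind_body rt_steps_0_trans)

section \<open>Towers and reduction of terms\<close>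

text \<open>Degree-zero steps can unfold every definition, drop it afterwards and erase every cast,
  which is what level \<open>0\<close> of the interpretation does.\<close>

lemma rt_steps_0_readback_sem:
  "(\<And>x. rt_steps nxt L 0 (Var x) (readback (\<sigma> x 0))) \<Longrightarrow>
    rt_steps nxt L 0 T (readback (sem nxt T \<sigma> 0))"
proof (induction T arbitrary: L \<sigma>)
  case (Bind b V T)
  have V: "rt_steps nxt L 0 V (readback (sem nxt V \<sigma> 0))" using Bind by blast
  have Suc: "rt_steps nxt ((b, V) # L) 0 (Var (Suc x)) (lift 0 (readback (\<sigma> x 0)))" for x
    using rt_steps_0_weaken[OF Bind.prems[of x], of b V] by simp
  show ?case
  proof (cases b)
    case Decl
    have "rt_steps nxt ((b, V) # L) 0 (Var x) (readback (push (sem nxt V \<sigma>) \<sigma> x 0))" for x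
      using Suc by (cases x) (auto simp: push_def intro: rt_steps.refl)
    then show ?thesis using V Bind(2) Decl by (auto intro: rt_steps_0_bind)
  next
    case Defn
    let ?\<sigma> = "case_nat (sem nxt V \<sigma>) \<sigma>"
    have "rt_steps nxt ((b, V) # L) 0 (Var x) (readback (ren Suc (?\<sigma> x 0)))" for x
      using Suc Defn rt_steps_0_trans[OF rt_steps.single[OF rt_step.defn] rt_steps_0_weaken[OF V]]
      by (cases x) auto
    then have "rt_steps nxt ((b, V) # L) 0 T (readback (sem nxt T (\<lambda>x j. ren Suc (?\<sigma> x j)) 0))"
      by (rule Bind(2))
    then have "rt_steps nxt L 0 (Bind b V T) (Bind b V (lift 0 (readback (sem nxt T ?\<sigma> 0))))"
      by (auto simp: ren_sem[symmetric] intro: rt_steps_0_bind rt_steps.refl)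
    then show ?thesis
      using Defn rt_steps_0_trans[OF _ rt_steps.single[OF rt_step.drop]] by auto
  qed
next
  case (Cast U T)
  have "rt_steps nxt L 0 (Cast U T) T" by (intro rt_steps.single rt_step.uncast)
  also have "rt_steps nxt L 0 T (readback (sem nxt T \<sigma> 0))" by (rule Cast)+
  finally show ?case by simp
qed (auto intro: rt_steps.refl rt_steps_0_app)

text \<open>Terms read back contain no definitions or casts, so interpreting one at level
  \<open>0\<close> is a substitution up to the higher annotation levels, which
  \<open>readback\<close> forgets.\<close>

lemma readback_sem_readback:
  "(\<And>x. readback (\<sigma> x 0) = readback (\<theta> x)) \<Longrightarrow>
    readback (sem nxt (readback X) \<sigma> 0) = readback (isubst \<theta> X)"
proof (induction X arbitrary: \<sigma> \<theta>)
  case (ILam w u)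
  have "readback (push v \<sigma> x 0) = readback (up \<theta> x)" for v x
    using ILam.prems by (cases x) (auto simp: push_def)
  then show ?case using ILam by simp
qed auto

text \<open>The bound \<open>Suc 0\<close> controls exactly annotation level \<open>0\<close>, the
  only one that \<open>readback\<close> keeps.\<close>

lemma par_readback: "par (Suc 0) X Y \<Longrightarrow> rt_steps nxt L 0 (readback X) (readback Y)"
proof (induction arbitrary: L rule: par.induct)
  case (par_beta v v' u u' w)
  let ?D = "Def (Cast (readback (w 0)) (readback v)) (readback u)"
  have v': "rt_steps nxt L 0 (Cast (readback (w 0)) (readback v)) (readback v')"
    using par_beta rt_steps_0_trans[OF rt_steps.single[OF rt_step.uncast]] by blast
  have "rt_steps nxt L 0 (App (readback v) (Lam (readback (w 0)) (readback u))) ?D"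
    by (intro rt_steps.single rt_step.beta)
  also have "rt_steps nxt L 0 ?D (Def (readback v') (readback u'))"
    using par_beta v' by (intro rt_steps_0_bind)
  \<comment> \<open>Unfolding through \<open>sem\<close> performs the substitution; the valuation
    leaves free variables alone.\<close>
  also have "rt_steps nxt L 0 (Def (readback v') (readback u'))
      (readback (sem nxt (Def (readback v') (readback u')) (\<lambda>x j. IVar x) 0))"
    by (rule rt_steps_0_readback_sem) (auto intro: rt_steps.refl)
  also have "readback (sem nxt (Def (readback v') (readback u')) (\<lambda>x j. IVar x) 0)
      = readback (isubst (case_nat v' IVar) u')"
    by (auto intro!: readback_sem_readback split: nat.split)
      (simp add: readback_sem_readback[where \<theta> = IVar])
  finally show ?case by simp
qed (auto intro: rt_steps.refl rt_steps_0_app rt_steps_0_bind)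

section \<open>The canonical valuation of an environment\<close>

text \<open>This valuation is compatible and, at level \<open>0\<close>, reachable by reduction from
  the variables. Under \<open>Defn\<close> the values are weakened by \<open>ren Suc\<close>, so
  that indices still count the defined entry and reading back gives terms over the whole
  environment.\<close>

fun canon :: "('s \<Rightarrow> 's) \<Rightarrow> 's env \<Rightarrow> nat \<Rightarrow> nat \<Rightarrow> 's itrm" where
  "canon nxt [] = (\<lambda>x i. IVar x)"
| "canon nxt ((Decl, W) # K) = push (sem nxt W (canon nxt K)) (canon nxt K)"
| "canon nxt ((Defn, V) # K) = (\<lambda>x i. ren Suc (case_nat (sem nxt V (canon nxt K)) (canon nxt K) x i))"

lemma compat_canon: "compat nxt L (canon nxt L)"
proof (induction L)
  case (Cons e K)
  obtain b V where e: "e = (b, V)" by (cases e)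
  show ?case
    using compat_push[OF Cons, of V] compat_ren[OF compat_case_nat[OF Cons, of V], of Suc]
    unfolding e by (cases b) auto
qed simp

lemma rt_steps_0_canon: "rt_steps nxt L 0 (Var x) (readback (canon nxt L x 0))"
proof (induction L arbitrary: x)
  case (Cons e K)
  obtain b V where e: "e = (b, V)" by (cases e)
  show ?case
  proof (cases x)
    case 0
    have "rt_steps nxt K 0 V (readback (sem nxt V (canon nxt K) 0))"
      using Cons by (rule rt_steps_0_readback_sem)
    then have "rt_steps nxt ((Defn, V) # K) 0 (Var 0) (lift 0 (readback (sem nxt V (canon nxt K) 0)))"
      by (rule rt_steps_0_trans[OF rt_steps.single[OF rt_step.defn] rt_steps_0_weaken])
    with 0 e show ?thesis by (cases b) (auto simp: push_def intro: rt_steps.refl)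
  next
    case (Suc y)
    with rt_steps_0_weaken[OF Cons[of y], of b V] e show ?thesis
      by (cases b) (auto simp: push_def)
  qed
qed (auto intro: rt_steps.refl)

theorem theorem5p4:
  fixes nxt :: "'s \<Rightarrow> 's" and A :: "nat set" and L :: "'s env" and T U1 U2 :: "'s trm"
  assumes "has_type nxt A L T U1" and "has_type nxt A L T U2"
  shows "\<exists>U0. rt_steps nxt L 0 U1 U0 \<and> rt_steps nxt L 0 U2 U0"
proof -
  let ?\<sigma> = "canon nxt L"
  have "sv nxt L (Cast U1 T)" "sv nxt L (Cast U2 T)"
    using assms valid_imp_sv unfolding has_type_def by blast+
  then have "sem nxt U1 ?\<sigma> 0 \<simeq> sem nxt T ?\<sigma> (Suc 0)" "sem nxt U2 ?\<sigma> 0 \<simeq> sem nxt T ?\<sigma> (Suc 0)"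
    using compat_canon sv_cast_sim by blast+
  then have "sem nxt U1 ?\<sigma> 0 \<simeq> sem nxt U2 ?\<sigma> 0"
    by (blast intro: sim_trans sim_sym)
  \<comment> \<open>The instance \<open>k = Suc 0\<close> of equality suffices for reading the
    common reduct back.\<close>
  then obtain Z where Z: "(par (Suc 0))\<^sup>*\<^sup>* (sem nxt U1 ?\<sigma> 0) Z" "(par (Suc 0))\<^sup>*\<^sup>* (sem nxt U2 ?\<sigma> 0) Z"
    unfolding sim_def joink_def by blast
  have "rt_steps nxt L 0 U (readback Z)" if "(par (Suc 0))\<^sup>*\<^sup>* (sem nxt U ?\<sigma> 0) Z" for U
    using that
    by (induction rule: rtranclp_induct)
      (blast intro: rt_steps_0_readback_sem rt_steps_0_canon rt_steps_0_trans par_readback)+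
  with Z show ?thesis by blast
qed

end
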